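(* Let $X$ be a nonzero real Banach lattice. If $\lambda^+(X)>1$, then $X$ satisfies a lower $q$-estimate for some $q\in(1,\infty)$. In particular, if $\lambda^+(X)>1$, then $X$ is a KB-space.
   Context: For a Banach lattice $X$, $S_X^+$ denotes the set of elements $x\in X$ with $x\ge 0$ and $\|x\|=1$. The lattice Schäffer constant is $\lambda^+(X)=\inf\{\max\{\|x-y\|,\|x+y\|\} : x,y\in S_X^+\}$. For $1\le q<\infty$, $X$ satisfies a lower $q$-estimate if there is a constant $M$ such that $M\left\|\sum_{i=1}^n x_i\right\|\ge\left(\sum_{i=1}^n\|x_i\|^q\right)^{1/q}$ for every finite family of pairwise disjoint elements $x_1,\dots,x_n\in X$. $X$ is a KB-space if every monotone sequence in the closed unit ball of $X$ is norm convergent. *)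

theory Defs
  imports "HOL-Analysis.Analysis" "HOL-Library.Lattice_Algebras"
begin

text \<open>Real Banach lattices.  The parent class \<^class>\<open>lattice_ab_group_add_abs\<close> provides
  the vector lattice structure with modulus \<open>\<bar>x\<bar> = sup x (- x)\<close>; the axiom below says that the
  complete norm is a lattice norm.\<close>

class banach_lattice = banach + ordered_real_vector + lattice_ab_group_add_abs +
  assumes lattice_norm: "\<bar>x\<bar> \<le> \<bar>y\<bar> \<Longrightarrow> norm x \<le> norm y"

instance real :: banach_lattice
  by standard simp

definition pos_sphere :: "'a::banach_lattice set"
  where "pos_sphere = {x. 0 \<le> x \<and> norm x = 1}"

text \<open>The infimum is taken in the reals, so the value is meaningful only for a nonzero space,
  where the set is nonempty (and bounded below by 0).\<close>

definition lattice_schaffer :: "'a::banach_lattice itself \<Rightarrow> real"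
  where "lattice_schaffer _ =
    Inf {max (norm (x - y)) (norm (x + y)) | x y :: 'a. x \<in> pos_sphere \<and> y \<in> pos_sphere}"

definition lattice_disjoint :: "'a::banach_lattice \<Rightarrow> 'a \<Rightarrow> bool"
  where "lattice_disjoint x y \<longleftrightarrow> inf \<bar>x\<bar> \<bar>y\<bar> = 0"

text \<open>Intended for \<open>1 \<le> q\<close>.  Disjointness is required for distinct indices, so a family may
  repeat only the zero vector.\<close>

definition lower_estimate :: "'a::banach_lattice itself \<Rightarrow> real \<Rightarrow> bool"
  where "lower_estimate _ q \<longleftrightarrow>
    (\<exists>M::real. \<forall>(n::nat) (x :: nat \<Rightarrow> 'a).
      (\<forall>i<n. \<forall>j<n. i \<noteq> j \<longrightarrow> lattice_disjoint (x i) (x j)) \<longrightarrow>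
      M * norm (\<Sum>i<n. x i) \<ge> (\<Sum>i<n. norm (x i) powr q) powr (1 / q))"

text \<open>\<^const>\<open>monoseq\<close> covers both increasing and decreasing sequences.\<close>

definition KB_space :: "'a::banach_lattice itself \<Rightarrow> bool"
  where "KB_space _ \<longleftrightarrow>
    (\<forall>x :: nat \<Rightarrow> 'a. monoseq x \<and> (\<forall>n. x n \<in> cball 0 1) \<longrightarrow> convergent x)"

end

theory Submission
  imports Defs
begin

text \<open>
  For positive \<open>x\<close>, \<open>y\<close> one has \<open>\<bar>x - y\<bar> \<le> x + y\<close>, so the maximum in the constant is just
  \<open>\<parallel>x + y\<parallel>\<close>.  Hence a constant \<open>c > 1\<close> means: adding two positive vectors of norm at least \<open>t\<close>
  yields a vector of norm at least \<open>c t\<close> (\<open>norm_add_ge_schaffer\<close>).  Adding along a binary tree,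
  \<open>2 ^ k\<close> positive vectors of norm at least \<open>t\<close> have a sum of norm at least \<open>c ^ k t\<close>.

  Write \<open>c = 2 powr (1 / p)\<close>.  The tree bound becomes the weak-type estimate
  \<open>n t\<^sup>p \<le> 2 \<parallel>\<Sum> x\<^sub>i\<parallel>\<^sup>p\<close> for \<open>n\<close> positive vectors of norm at least \<open>t\<close>: it bounds how many of the
  \<open>x\<^sub>i\<close> can be large.  As usual, a weak estimate with exponent \<open>p\<close> gives a strong one with any
  larger exponent: the \<open>k\<close>-th largest of the \<open>\<parallel>x\<^sub>i\<parallel>\<^sup>p\<close> is at most \<open>2 \<parallel>\<Sum> x\<^sub>i\<parallel>\<^sup>p / k\<close>, and the squares
  of these numbers are summable, so \<open>q = 2 p\<close> works.  Disjoint families reduce to positive ones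
  because \<open>\<bar>\<Sum> x\<^sub>i\<bar> = \<Sum> \<bar>x\<^sub>i\<bar>\<close> for them.

  The same doubling gives the KB property without passing through the lower estimate: if an
  increasing sequence is not Cauchy, then from every index on it has increments of norm at least
  some fixed \<open>e > 0\<close>, and joining two consecutive increments repeatedly produces increments of norm
  at least \<open>c ^ k e\<close> for all \<open>k\<close>, so the sequence is unbounded.
\<close>

section \<open>Disjoint elements\<close>

lemma norm_mono_pos:
  fixes x y :: "'a::banach_lattice"
  assumes "0 \<le> x" "x \<le> y"
  shows "norm x \<le> norm y"
  using assms by (intro lattice_norm) (auto simp: abs_of_nonneg)

lemma norm_abs_lattice [simp]:
  fixes x :: "'a::banach_lattice"
  shows "norm \<bar>x\<bar> = norm x"
  by (intro antisym lattice_norm) simp_all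

text \<open>Half of the Riesz decomposition property; it makes disjointness from a fixed element stable
  under sums.\<close>

lemma inf_add_le:
  fixes a b c :: "'a::lattice_ab_group_add"
  assumes "0 \<le> a" "0 \<le> b" "0 \<le> c"
  shows "inf a (b + c) \<le> inf a b + inf a c"
proof -
  have "inf a b + inf a c = inf (inf (a + a) (a + c)) (inf (b + a) (b + c))"
    by (simp add: add_inf_distrib_left add_inf_distrib_right inf_aci)
  moreover have "inf a (b + c) \<le> a + a" "inf a (b + c) \<le> a + c" "inf a (b + c) \<le> b + a"
    using assms by (auto intro: le_infI1 add_increasing add_increasing2)
  ultimately show ?thesis by simp
qed

text \<open>Disjointness gives \<open>\<bar>x\<bar> \<le> \<bar>x + y\<bar>\<close>, since the part of \<open>\<bar>x\<bar> \<le> \<bar>x + y\<bar> + \<bar>y\<bar>\<close> that comes from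
  \<open>\<bar>y\<bar>\<close> cannot contribute; symmetrically for \<open>y\<close>.  And \<open>\<bar>x\<bar> + \<bar>y\<bar>\<close> is the supremum of the two.\<close>

lemma abs_add_disjoint:
  fixes x y :: "'a::banach_lattice"
  assumes "lattice_disjoint x y"
  shows "\<bar>x + y\<bar> = \<bar>x\<bar> + \<bar>y\<bar>"
proof (rule antisym)
  have le: "\<bar>u\<bar> \<le> \<bar>u + v\<bar>" if "inf \<bar>u\<bar> \<bar>v\<bar> = 0" for u v :: 'a
  proof -
    have "\<bar>u\<bar> \<le> \<bar>u + v\<bar> + \<bar>v\<bar>"
      using abs_triangle_ineq4[of "u + v" v] by simp
    hence "\<bar>u\<bar> = inf \<bar>u\<bar> (\<bar>u + v\<bar> + \<bar>v\<bar>)"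
      by (simp add: inf_absorb1)
    also have "\<dots> \<le> inf \<bar>u\<bar> \<bar>u + v\<bar> + inf \<bar>u\<bar> \<bar>v\<bar>"
      by (intro inf_add_le) auto
    also have "\<dots> \<le> \<bar>u + v\<bar>"
      using that by simp
    finally show ?thesis .
  qed
  have *: "inf \<bar>x\<bar> \<bar>y\<bar> = 0"
    using assms by (simp add: lattice_disjoint_def)
  have "\<bar>x\<bar> + \<bar>y\<bar> = sup \<bar>x\<bar> \<bar>y\<bar>"
    using * add_eq_inf_sup[of "\<bar>x\<bar>" "\<bar>y\<bar>"] by simp
  also have "\<dots> \<le> \<bar>x + y\<bar>"
    using le[of x y] le[of y x] * by (simp add: inf_commute add.commute)
  finally show "\<bar>x\<bar> + \<bar>y\<bar> \<le> \<bar>x + y\<bar>" .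
qed (rule abs_triangle_ineq)

lemma lattice_disjoint_sum:
  fixes y :: "'a::banach_lattice"
  assumes "finite A" "\<And>i. i \<in> A \<Longrightarrow> lattice_disjoint y (x i)"
  shows "lattice_disjoint y (\<Sum>i\<in>A. x i)"
  using assms
proof (induction A rule: finite_induct)
  case empty
  show ?case by (simp add: lattice_disjoint_def inf_absorb2)
next
  case (insert a A)
  have "inf \<bar>y\<bar> \<bar>\<Sum>i\<in>insert a A. x i\<bar> \<le> inf \<bar>y\<bar> (\<bar>x a\<bar> + \<bar>\<Sum>i\<in>A. x i\<bar>)"
    using insert.hyps by (intro inf_mono) (auto intro: abs_triangle_ineq)
  also have "\<dots> \<le> inf \<bar>y\<bar> \<bar>x a\<bar> + inf \<bar>y\<bar> \<bar>\<Sum>i\<in>A. x i\<bar>"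
    by (intro inf_add_le) auto
  also have "\<dots> = 0"
    using insert by (simp add: lattice_disjoint_def)
  finally show ?case
    unfolding lattice_disjoint_def by (intro antisym) auto
qed

lemma abs_sum_disjoint:
  fixes x :: "'i \<Rightarrow> 'a::banach_lattice"
  assumes "finite A" "\<And>i j. i \<in> A \<Longrightarrow> j \<in> A \<Longrightarrow> i \<noteq> j \<Longrightarrow> lattice_disjoint (x i) (x j)"
  shows "\<bar>\<Sum>i\<in>A. x i\<bar> = (\<Sum>i\<in>A. \<bar>x i\<bar>)"
  using assms
proof (induction A rule: finite_induct)
  case (insert a A)
  have "lattice_disjoint (x a) (\<Sum>i\<in>A. x i)"
    using insert.hyps insert.prems by (intro lattice_disjoint_sum) auto
  thus ?case
    using insert by (simp add: abs_add_disjoint)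
qed simp

section \<open>Growth of norms under addition of positive vectors\<close>

lemma lattice_schaffer_le:
  fixes x y :: "'a::banach_lattice"
  assumes "x \<in> pos_sphere" "y \<in> pos_sphere"
  shows "lattice_schaffer TYPE('a) \<le> norm (x + y)"
proof -
  have pos: "0 \<le> x" "0 \<le> y"
    using assms by (auto simp: pos_sphere_def)
  have "\<bar>x - y\<bar> \<le> \<bar>x + y\<bar>"
    using abs_triangle_ineq4[of x y] pos by simp
  hence "max (norm (x - y)) (norm (x + y)) = norm (x + y)"
    by (simp add: lattice_norm max_absorb2)
  hence "norm (x + y) \<in> {max (norm (x - y)) (norm (x + y)) |x y :: 'a. x \<in> pos_sphere \<and> y \<in> pos_sphere}"
    using assms by force
  thus ?thesis
    unfolding lattice_schaffer_def
    by (intro cInf_lower) (auto intro!: bdd_belowI[of _ 0] simp: le_max_iff_disj)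
qed

text \<open>Shrinking both vectors to norm exactly \<open>t\<close> only decreases the norm of the sum.\<close>

lemma norm_add_ge_schaffer:
  fixes x y :: "'a::banach_lattice"
  assumes "0 \<le> x" "0 \<le> y" "t \<le> norm x" "t \<le> norm y" "0 < t"
  shows "lattice_schaffer TYPE('a) * t \<le> norm (x + y)"
proof -
  have sph: "sgn u \<in> pos_sphere" and shrink: "t *\<^sub>R sgn u \<le> u"
    if "0 \<le> u" "t \<le> norm u" for u :: 'a
  proof -
    have "u \<noteq> 0" using that assms(5) by auto
    thus "sgn u \<in> pos_sphere"
      using that by (auto simp: pos_sphere_def sgn_div_norm norm_sgn intro: scaleR_nonneg_nonneg)
    have "(t / norm u) *\<^sub>R u \<le> 1 *\<^sub>R u"
      using that \<open>u \<noteq> 0\<close> by (intro scaleR_right_mono) (auto simp: divide_le_eq_1)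
    thus "t *\<^sub>R sgn u \<le> u"
      by (simp add: sgn_div_norm divide_inverse)
  qed
  have "lattice_schaffer TYPE('a) * t \<le> norm (sgn x + sgn y) * t"
    using assms by (intro mult_right_mono lattice_schaffer_le sph) auto
  also have "\<dots> = norm (t *\<^sub>R sgn x + t *\<^sub>R sgn y)"
    using \<open>0 < t\<close> by (simp flip: scaleR_add_right)
  also have "\<dots> \<le> norm (x + y)"
    using assms sph[of x] sph[of y]
    by (intro norm_mono_pos add_mono shrink add_nonneg_nonneg scaleR_nonneg_nonneg)
       (auto simp: pos_sphere_def)
  finally show ?thesis .
qed

lemma norm_sum_ge_schaffer_power:
  fixes x :: "'i \<Rightarrow> 'a::banach_lattice"
  assumes "finite A" "2 ^ k \<le> card A" "0 < t" "0 < lattice_schaffer TYPE('a)"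
    and "\<And>i. i \<in> A \<Longrightarrow> 0 \<le> x i" "\<And>i. i \<in> A \<Longrightarrow> t \<le> norm (x i)"
  shows "lattice_schaffer TYPE('a) ^ k * t \<le> norm (\<Sum>i\<in>A. x i)"
  using assms
proof (induction k arbitrary: A)
  case 0
  then obtain a where a: "a \<in> A"
    by (cases "A = {}") auto
  have "t \<le> norm (x a)" using 0 a by auto
  also have "\<dots> \<le> norm (\<Sum>i\<in>A. x i)"
    using 0 a sum_mono2[of A "{a}" x] by (intro norm_mono_pos) auto
  finally show ?case by simp
next
  case (Suc k)
  obtain B where B: "B \<subseteq> A" "card B = 2 ^ k"
    using obtain_subset_with_card_n[of "2 ^ k" A] Suc.prems(2) by auto
  have fin: "finite B" "finite (A - B)"
    using B Suc.prems(1) by (auto intro: finite_subset)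
  have card: "2 ^ k \<le> card (A - B)"
    using B fin Suc.prems(2) by (simp add: card_Diff_subset)
  have "lattice_schaffer TYPE('a) * (lattice_schaffer TYPE('a) ^ k * t)
      \<le> norm ((\<Sum>i\<in>B. x i) + (\<Sum>i\<in>A - B. x i))"
    using B fin card Suc.prems
    by (intro norm_add_ge_schaffer Suc.IH sum_nonneg mult_pos_pos zero_less_power) auto
  also have "(\<Sum>i\<in>B. x i) + (\<Sum>i\<in>A - B. x i) = (\<Sum>i\<in>A. x i)"
    using B Suc.prems(1) by (simp add: sum.subset_diff add.commute)
  finally show ?case by (simp add: mult_ac)
qed

section \<open>The lower estimate\<close>

text \<open>The weak-type form of the tree bound.  With \<open>2 ^ k \<le> n < 2 ^ (k + 1)\<close> the tree uses \<open>2 ^ k\<close>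
  of the \<open>n\<close> vectors; the factor \<open>2\<close> pays for the others.\<close>

lemma card_mult_powr_le_norm_sum:
  fixes x :: "'i \<Rightarrow> 'a::banach_lattice"
  assumes A: "finite A" "A \<noteq> {}" and "0 \<le> t" "0 < p"
    and c: "lattice_schaffer TYPE('a) = 2 powr (1 / p)"
    and x: "\<And>i. i \<in> A \<Longrightarrow> 0 \<le> x i" "\<And>i. i \<in> A \<Longrightarrow> t \<le> norm (x i)"
  shows "real (card A) * t powr p \<le> 2 * norm (\<Sum>i\<in>A. x i) powr p"
proof (cases "t = 0")
  case False
  hence t: "0 < t" using \<open>0 \<le> t\<close> by simp
  have "1 \<le> card A" using A by (simp add: Suc_le_eq card_gt_0_iff)
  then obtain k where k: "2 ^ k \<le> card A" "card A < 2 ^ (k + 1)"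
    using ex_power_ivl1[of 2 "card A"] by auto
  have "real (card A) \<le> 2 * 2 ^ k"
    using k(2) by (metis less_imp_le of_nat_le_iff of_nat_numeral of_nat_power power_Suc Suc_eq_plus1)
  also have "(2::real) ^ k = (lattice_schaffer TYPE('a) ^ k) powr p"
    using \<open>0 < p\<close> by (simp add: c powr_powr powr_power powr_realpow)
  finally have "real (card A) * t powr p \<le> 2 * (lattice_schaffer TYPE('a) ^ k) powr p * t powr p"
    by (intro mult_right_mono) auto
  also have "\<dots> = 2 * (lattice_schaffer TYPE('a) ^ k * t) powr p"
    using t by (simp add: powr_mult c)
  also have "\<dots> \<le> 2 * norm (\<Sum>i\<in>A. x i) powr p"
    using norm_sum_ge_schaffer_power[of A k t x] A k t x \<open>0 < p\<close>
    by (intro mult_left_mono powr_mono2) (auto simp: c)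
  finally show ?thesis .
qed (use \<open>0 < p\<close> in auto)

text \<open>Weak type to strong type.  Removing a smallest element first plays the role of sorting: the
  smallest of \<open>n\<close> numbers is at most \<open>C / n\<close>.  The bound \<open>2 - 1 / n\<close> is the familiar telescoping
  estimate of \<open>\<Sum> 1 / k\<^sup>2\<close>; at \<open>n = 0\<close> its value is \<open>2\<close>, as \<open>1 / 0 = 0\<close>.\<close>

lemma sum_squares_le_weak_type:
  fixes b :: "'i \<Rightarrow> real"
  assumes "finite A" "0 \<le> C" "\<And>i. i \<in> A \<Longrightarrow> 0 \<le> b i"
    and "\<And>B s. B \<subseteq> A \<Longrightarrow> B \<noteq> {} \<Longrightarrow> 0 \<le> s \<Longrightarrow> (\<And>i. i \<in> B \<Longrightarrow> s \<le> b i) \<Longrightarrow> real (card B) * s \<le> C"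
  shows "(\<Sum>i\<in>A. (b i)\<^sup>2) \<le> C\<^sup>2 * (2 - 1 / real (card A))"
  using assms
proof (induction "card A" arbitrary: A)
  case 0
  thus ?case by simp
next
  case (Suc n)
  hence "A \<noteq> {}" by auto
  then obtain a where a: "a \<in> A" "\<And>i. i \<in> A \<Longrightarrow> b a \<le> b i"
    using arg_min_if_finite[of A b] Suc.prems(1) by (metis not_less)
  have n: "n = card (A - {a})" using a Suc by simp
  have "real (Suc n) * b a \<le> C"
    using Suc.prems(3,4) Suc.hyps(2) a \<open>A \<noteq> {}\<close> by (metis order_refl)
  hence "b a \<le> C / real (Suc n)"
    by (simp add: field_simps)
  hence "(b a)\<^sup>2 \<le> (C / real (Suc n))\<^sup>2"
    using Suc.prems(3) a by (intro power_mono) auto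
  moreover have "(\<Sum>i\<in>A - {a}. (b i)\<^sup>2) \<le> C\<^sup>2 * (2 - 1 / real n)"
  proof -
    have "(\<Sum>i\<in>A - {a}. (b i)\<^sup>2) \<le> C\<^sup>2 * (2 - 1 / real (card (A - {a})))"
    proof (rule Suc.hyps(1)[OF n])
      show "real (card B) * s \<le> C"
        if "B \<subseteq> A - {a}" "B \<noteq> {}" "0 \<le> s" "\<And>i. i \<in> B \<Longrightarrow> s \<le> b i" for B s
        using that by (intro Suc.prems(4)) auto
    qed (use Suc.prems(1-3) in auto)
    thus ?thesis using n by simp
  qed
  moreover have "(\<Sum>i\<in>A. (b i)\<^sup>2) = (b a)\<^sup>2 + (\<Sum>i\<in>A - {a}. (b i)\<^sup>2)"
    using a Suc.prems(1) by (simp add: sum.remove)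
  ultimately have le: "(\<Sum>i\<in>A. (b i)\<^sup>2) \<le> C\<^sup>2 * ((1 / real (Suc n))\<^sup>2 + (2 - 1 / real n))"
    by (simp add: algebra_simps power_divide)
  show ?case
  proof (cases "n = 0")
    case True
    \<comment> \<open>The default value of the bound at \<open>n = 0\<close> is too large for the induction step.\<close>
    have "A = {a}" using True Suc.hyps(2) a(1) by (metis One_nat_def card_1_singletonE singletonD)
    thus ?thesis
      using True \<open>(b a)\<^sup>2 \<le> _\<close> by simp
  next
    case False
    have "(1 / real (Suc n))\<^sup>2 \<le> 1 / (real n * real (Suc n))"
      unfolding power2_eq_square times_divide_times_eq mult_1
      using False by (intro divide_left_mono mult_right_mono) auto
    also have "\<dots> = 1 / real n - 1 / real (Suc n)"
      using False by (simp add: field_simps)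
    finally have "(1 / real (Suc n))\<^sup>2 + (2 - 1 / real n) \<le> 2 - 1 / real (Suc n)"
      by simp
    hence "C\<^sup>2 * ((1 / real (Suc n))\<^sup>2 + (2 - 1 / real n)) \<le> C\<^sup>2 * (2 - 1 / real (Suc n))"
      by (intro mult_left_mono) auto
    thus ?thesis using le Suc.hyps(2) by simp
  qed
qed

lemma sum_norm_powr_le:
  fixes x :: "'i \<Rightarrow> 'a::banach_lattice"
  assumes "finite A" "0 < p" and c: "lattice_schaffer TYPE('a) = 2 powr (1 / p)"
    and x: "\<And>i. i \<in> A \<Longrightarrow> 0 \<le> x i"
  shows "(\<Sum>i\<in>A. norm (x i) powr (2 * p)) \<le> 8 * norm (\<Sum>i\<in>A. x i) powr (2 * p)"
proof -
  define C where "C = 2 * norm (\<Sum>i\<in>A. x i) powr p"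
  have sq: "(r powr p)\<^sup>2 = r powr (2 * p)" for r :: real
    by (simp add: power2_eq_square flip: powr_add)
  have "(\<Sum>i\<in>A. (norm (x i) powr p)\<^sup>2) \<le> C\<^sup>2 * (2 - 1 / real (card A))"
  proof (rule sum_squares_le_weak_type)
    fix B s
    assume B: "B \<subseteq> A" "B \<noteq> {}" and s: "0 \<le> s" "\<And>i. i \<in> B \<Longrightarrow> s \<le> norm (x i) powr p"
    have fin: "finite B" using B assms(1) by (auto intro: finite_subset)
    have "s powr (1 / p) \<le> norm (x i)" if "i \<in> B" for i
      using powr_mono2[of "1 / p" s "norm (x i) powr p"] s that \<open>0 < p\<close> by (simp add: powr_powr)
    hence "real (card B) * (s powr (1 / p)) powr p \<le> 2 * norm (\<Sum>i\<in>B. x i) powr p"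
      using B fin x \<open>0 < p\<close> c by (intro card_mult_powr_le_norm_sum) auto
    also have "\<dots> \<le> C"
      unfolding C_def using B x assms(1) \<open>0 < p\<close>
      by (intro mult_left_mono powr_mono2 norm_mono_pos sum_nonneg sum_mono2) auto
    finally show "real (card B) * s \<le> C"
      using s(1) \<open>0 < p\<close> by (simp add: powr_powr)
  qed (use assms(1) in \<open>auto simp: C_def\<close>)
  also have "\<dots> \<le> C\<^sup>2 * 2"
    by (intro mult_left_mono) auto
  finally show ?thesis
    by (simp add: sq C_def power_mult_distrib)
qed

lemma lower_estimate_if_schaffer:
  assumes "0 < p" and c: "lattice_schaffer TYPE('a::banach_lattice) = 2 powr (1 / p)"
  shows "lower_estimate TYPE('a) (2 * p)"
  unfolding lower_estimate_def
proof (intro exI allI impI)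
  fix n and x :: "nat \<Rightarrow> 'a"
  assume dis: "\<forall>i<n. \<forall>j<n. i \<noteq> j \<longrightarrow> lattice_disjoint (x i) (x j)"
  have "norm (\<Sum>i<n. \<bar>x i\<bar>) = norm (\<Sum>i<n. x i)"
    using dis abs_sum_disjoint[of "{..<n}" x] by (metis finite_lessThan lessThan_iff norm_abs_lattice)
  hence "(\<Sum>i<n. norm (x i) powr (2 * p)) \<le> 8 * norm (\<Sum>i<n. x i) powr (2 * p)"
    using sum_norm_powr_le[of "{..<n}" p "\<lambda>i. \<bar>x i\<bar>"] assms by simp
  hence "(\<Sum>i<n. norm (x i) powr (2 * p)) powr (1 / (2 * p))
      \<le> (8 * norm (\<Sum>i<n. x i) powr (2 * p)) powr (1 / (2 * p))"
    using \<open>0 < p\<close> by (intro powr_mono2 sum_nonneg) auto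
  also have "\<dots> = 8 powr (1 / (2 * p)) * norm (\<Sum>i<n. x i)"
    using \<open>0 < p\<close> by (simp add: powr_mult powr_powr)
  finally show "(\<Sum>i<n. norm (x i) powr (2 * p)) powr (1 / (2 * p))
      \<le> 8 powr (1 / (2 * p)) * norm (\<Sum>i<n. x i)" .
qed

section \<open>Convergence of bounded monotone sequences\<close>

lemma convergent_if_incseq_bounded:
  fixes x :: "nat \<Rightarrow> 'a::banach_lattice"
  assumes c: "1 < lattice_schaffer TYPE('a)" and inc: "incseq x" and bd: "\<And>n. norm (x n) \<le> R"
  shows "convergent x"
proof -
  let ?c = "lattice_schaffer TYPE('a)"
  have "Cauchy x"
  proof (rule ccontr)
    assume "\<not> Cauchy x"
    then obtain e where e: "0 < e" "\<And>m. \<exists>n\<ge>m. e \<le> norm (x n - x m)"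
      unfolding Cauchy_altdef2 dist_norm by (meson not_less)
    have grow: "\<exists>n\<ge>m. ?c ^ k * e \<le> norm (x n - x m)" for k m
    proof (induction k arbitrary: m)
      case (Suc k)
      obtain n where n: "m \<le> n" "?c ^ k * e \<le> norm (x n - x m)"
        using Suc by blast
      obtain l where l: "n \<le> l" "?c ^ k * e \<le> norm (x l - x n)"
        using Suc by blast
      have "?c * (?c ^ k * e) \<le> norm ((x l - x n) + (x n - x m))"
        using n l c e(1) incseqD[OF inc] by (intro norm_add_ge_schaffer) auto
      thus ?case
        using n(1) l(1) by (intro exI[of _ l]) (simp add: mult_ac)
    qed (use e in simp)
    obtain k where "2 * R / e < ?c ^ k"
      using real_arch_pow[OF c] by blast
    hence k: "2 * R < ?c ^ k * e"
      using e(1) by (simp add: field_simps)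
    obtain n where "?c ^ k * e \<le> norm (x n - x 0)"
      using grow by blast
    also have "\<dots> \<le> 2 * R"
      using norm_triangle_ineq4[of "x n" "x 0"] bd[of n] bd[of 0] by linarith
    finally show False using k by simp
  qed
  thus ?thesis by (simp add: Cauchy_convergent)
qed

lemma KB_space_if_schaffer:
  assumes "1 < lattice_schaffer TYPE('a::banach_lattice)"
  shows "KB_space TYPE('a)"
  unfolding KB_space_def
proof (intro allI impI)
  fix x :: "nat \<Rightarrow> 'a"
  assume x: "monoseq x \<and> (\<forall>n. x n \<in> cball 0 1)"
  then consider "incseq x" | "incseq (\<lambda>n. - x n)"
    by (auto simp: monoseq_iff decseq_def incseq_def)
  thus "convergent x"
  proof cases
    case 1
    thus ?thesis
      using convergent_if_incseq_bounded[of x 1] assms x by simp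
  next
    case 2
    hence "convergent (\<lambda>n. - x n)"
      using convergent_if_incseq_bounded[of "\<lambda>n. - x n" 1] assms x by simp
    thus ?thesis
      by (simp add: convergent_minus_iff[symmetric])
  qed
qed

section \<open>Lattice Schaeffer constant above one\<close>

theorem theorem6p6:
  assumes "\<exists>x :: 'a::banach_lattice. x \<noteq> 0"
    and "lattice_schaffer TYPE('a) > 1"
  shows "(\<exists>q. 1 < q \<and> lower_estimate TYPE('a) q) \<and> KB_space TYPE('a)"
proof
  let ?c = "lattice_schaffer TYPE('a)"
  obtain x :: 'a where "x \<noteq> 0"
    using assms(1) by blast
  hence e: "sgn \<bar>x\<bar> \<in> pos_sphere"
    by (auto simp: pos_sphere_def sgn_div_norm intro: scaleR_nonneg_nonneg)
  \<comment> \<open>The pair \<open>(e, e)\<close> bounds the constant by \<open>2\<close>, so that the exponent \<open>p\<close> below is at least \<open>1\<close>.\<close>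
  have "?c \<le> norm (sgn \<bar>x\<bar> + sgn \<bar>x\<bar>)"
    by (rule lattice_schaffer_le[OF e e])
  also have "\<dots> = 2"
    using e by (simp add: pos_sphere_def flip: scaleR_2)
  finally have "?c \<le> 2" .
  define p where "p = 1 / log 2 ?c"
  have log: "0 < log 2 ?c" "log 2 ?c \<le> 1"
    using assms(2) \<open>?c \<le> 2\<close> by auto
  hence p: "1 \<le> p" by (simp add: p_def)
  have "?c = 2 powr (1 / p)"
    using assms(2) by (simp add: p_def)
  hence "lower_estimate TYPE('a) (2 * p)"
    using p by (intro lower_estimate_if_schaffer) auto
  thus "\<exists>q. 1 < q \<and> lower_estimate TYPE('a) q"
    using p by (intro exI[of _ "2 * p"]) auto
  show "KB_space TYPE('a)"
    using assms(2) by (rule KB_space_if_schaffer)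
qed

end
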